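(* For any positive real numbers $a$ and $b$ the following are true, where all products are the geometric product: (1) $(-a)(-b)=ab$; (2) $(-a)b=a(-b)=-(ab)$.
   Context: Work in the Euclidean plane (with Euclid's/Hilbert's axioms of plane geometry) with perpendicular $x$- and $y$-axes meeting at the origin $(0,0)$ and a common unit length on both axes. A line is regarded as parallel to itself. Geometric product: for real numbers $a$ and $b$, lay $a$ along the $y$-axis and $b$ along the $x$-axis; $ab$ ("$a$ multiplied by $b$") is defined to be the $x$-intercept of the line through the point $(0,a)$ that is parallel to the segment joining $(b,0)$ and $(0,1)$. Every product in the claim is meant in this sense; no other notion of multiplication is presupposed. *)

theory Defs
  imports "HOL-Analysis.Analysis"
begin

type_synonym point = "real \<times> real"

definition line_through :: "point \<Rightarrow> point \<Rightarrow> point set"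
  where "line_through p q = affine hull {p, q}"

definition is_line :: "point set \<Rightarrow> bool"
  where "is_line L \<longleftrightarrow> (\<exists>p q. p \<noteq> q \<and> L = line_through p q)"

(* Euclid's notion (lines that do not meet), with every line parallel to itself.
   On lines it agrees with the library's affine_parallel; see parallel_iff_affine_parallel. *)
definition parallel :: "point set \<Rightarrow> point set \<Rightarrow> bool"
  where "parallel L M \<longleftrightarrow> L = M \<or> L \<inter> M = {}"

(* The number x is unique for all real a and b, zero and negative values included;
   see geom_prod_well_defined. Being parallel to a segment means being parallel to the line
   that carries it. *)
definition geom_prod :: "real \<Rightarrow> real \<Rightarrow> real"  (infixl "\<odot>" 70)
  where "a \<odot> b =
    (THE x. \<exists>L. is_line L \<and> (0, a) \<in> L \<and> parallel L (line_through (b, 0) (0, 1)) \<and> (x, 0) \<in> L)"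

lemma line_through_iff:
  "z \<in> line_through p q \<longleftrightarrow>
    (\<exists>u. fst z = fst p + u * (fst q - fst p) \<and> snd z = snd p + u * (snd q - snd p))"
  unfolding line_through_def affine_hull_2_alt by (auto simp: prod_eq_iff)

lemma is_line_eq_line_through:
  assumes "is_line L" "p \<in> L" "q \<in> L" "p \<noteq> q"
  shows "L = line_through p q"
proof -
  from assms(1) obtain r s where rs: "r \<noteq> s" "L = affine hull {r, s}"
    by (auto simp: is_line_def line_through_def)
  have "affine hull {p, q} \<subseteq> L"
    using assms(2,3) rs(2) by (intro hull_minimal) auto
  moreover have "aff_dim (affine hull {p, q}) = aff_dim L"
    using rs assms(4) by (simp add: aff_dim_2)
  ultimately have "affine hull {p, q} = L"
    using rs(2) by (intro affine_dim_equal) auto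
  then show ?thesis by (simp add: line_through_def)
qed

lemma parallel_iff_affine_parallel:
  assumes "is_line L" "is_line M"
  shows "parallel L M \<longleftrightarrow> affine_parallel L M"
proof
  obtain p q where pq: "p \<noteq> q" "L = line_through p q"
    using assms(1) by (auto simp: is_line_def)
  obtain r s where rs: "r \<noteq> s" "M = line_through r s"
    using assms(2) by (auto simp: is_line_def)
  define d where "d = q - p"
  define e where "e = s - r"
  have L: "L = range (\<lambda>u. p + u *\<^sub>R d)" and M: "M = range (\<lambda>u. r + u *\<^sub>R e)"
    by (simp_all add: pq rs line_through_def affine_hull_2_alt d_def e_def)
  have nz: "d \<noteq> 0" "e \<noteq> 0" using pq rs by (auto simp: d_def e_def)
  show "affine_parallel L M" if par: "parallel L M"
  proof (cases "L = M")
    case True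
    then show ?thesis by (simp add: affine_parallel_reflex)
  next
    case False
    with par have disj: "L \<inter> M = {}" by (simp add: parallel_def)
    have det: "fst d * snd e - snd d * fst e = 0"
    proof (rule ccontr)
      define D where "D = fst d * snd e - snd d * fst e"
      assume "fst d * snd e - snd d * fst e \<noteq> 0"
      then have D: "D \<noteq> 0" by (simp add: D_def)
      define u where "u = ((fst r - fst p) * snd e - (snd r - snd p) * fst e) / D"
      define v where "v = ((fst r - fst p) * snd d - (snd r - snd p) * fst d) / D"
      have "p + u *\<^sub>R d = r + v *\<^sub>R e"
        using D unfolding u_def v_def
        by (simp add: prod_eq_iff field_simps) (simp add: D_def algebra_simps)
      then show False using disj by (auto simp: L M)
    qed
    have "\<exists>k. e = k *\<^sub>R d"
    proof (cases "fst d = 0")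
      case True
      with det nz show ?thesis
        by (intro exI[of _ "snd e / snd d"]) (auto simp: prod_eq_iff)
    next
      case False
      with det show ?thesis
        by (intro exI[of _ "fst e / fst d"]) (auto simp: prod_eq_iff field_simps)
    qed
    then obtain k where k: "e = k *\<^sub>R d" by blast
    with nz have k0: "k \<noteq> 0" by auto
    have "M = (\<lambda>x. (r - p) + x) ` L"
    proof (intro equalityI subsetI)
      fix x assume "x \<in> M"
      then obtain u where "x = r + u *\<^sub>R e" by (auto simp: M)
      then have "x = (r - p) + (p + (u * k) *\<^sub>R d)" by (simp add: k)
      then show "x \<in> (\<lambda>x. (r - p) + x) ` L" unfolding L by blast
    next
      fix x assume "x \<in> (\<lambda>x. (r - p) + x) ` L"
      then obtain u where "x = (r - p) + (p + u *\<^sub>R d)" unfolding L by blast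
      then have "x = r + (u / k) *\<^sub>R e" using k0 by (simp add: k)
      then show "x \<in> M" unfolding M by blast
    qed
    then show ?thesis unfolding affine_parallel_def by blast
  qed
  show "parallel L M" if par: "affine_parallel L M"
  proof (cases "L \<inter> M = {}")
    case True
    then show ?thesis by (simp add: parallel_def)
  next
    case False
    then obtain z where z: "z \<in> L" "z \<in> M" by blast
    obtain a where a: "M = (\<lambda>x. a + x) ` L"
      using par unfolding affine_parallel_def by blast
    obtain u where u: "z = p + u *\<^sub>R d" using z unfolding L by blast
    obtain v where v: "z = a + (p + v *\<^sub>R d)" using z unfolding a L by blast
    have ad: "a = (u - v) *\<^sub>R d" using u v by (simp add: algebra_simps)
    have "a + (p + w *\<^sub>R d) = p + (u - v + w) *\<^sub>R d" for w
      by (simp add: ad algebra_simps)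
    then have "M \<subseteq> L" by (auto simp: a L)
    moreover have "aff_dim M = aff_dim L"
      using pq rs by (simp add: line_through_def aff_dim_2)
    ultimately have "M = L"
      using rs by (intro affine_dim_equal) (auto simp: pq line_through_def)
    then show ?thesis by (simp add: parallel_def)
  qed
qed

lemma geom_prod_well_defined:
  "\<exists>!x. \<exists>L. is_line L \<and> (0, a) \<in> L \<and> parallel L (line_through (b, 0) (0, 1)) \<and> (x, 0) \<in> L"
proof (rule ex1I)
  define M where "M = line_through (b, 0) (0, 1)"
  have M: "(s, t) \<in> M \<longleftrightarrow> s = b - t * b" for s t
    by (auto simp: M_def line_through_iff)
  define N where "N = line_through (0, a) (b, a - 1)"
  have N: "(s, t) \<in> N \<longleftrightarrow> s = (a - t) * b" for s t
  proof
    show "(s, t) \<in> N" if "s = (a - t) * b"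
      using that unfolding N_def line_through_iff by (intro exI[of _ "a - t"]) auto
  qed (auto simp: N_def line_through_iff algebra_simps)
  have "is_line N" unfolding is_line_def N_def by (intro exI conjI) (auto simp: prod_eq_iff)
  moreover have "parallel N M"
  proof (cases "a = 1 \<or> b = 0")
    case True
    then have "N = M" by (auto simp: M N algebra_simps set_eq_iff)
    then show ?thesis by (simp add: parallel_def)
  next
    case False
    then have "(a - t) * b \<noteq> b - t * b" for t by (simp add: algebra_simps)
    then have "N \<inter> M = {}" by (auto simp: M N)
    then show ?thesis by (simp add: parallel_def)
  qed
  ultimately show "\<exists>L. is_line L \<and> (0, a) \<in> L \<and> parallel L (line_through (b, 0) (0, 1)) \<and> (a * b, 0) \<in> L"
    by (intro exI[of _ N]) (simp add: N M_def)
  fix x assume "\<exists>L. is_line L \<and> (0, a) \<in> L \<and> parallel L (line_through (b, 0) (0, 1)) \<and> (x, 0) \<in> L"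
  then obtain L where L: "is_line L" "(0, a) \<in> L" "parallel L M" "(x, 0) \<in> L"
    by (auto simp: M_def)
  show "x = a * b"
  proof (rule ccontr)
    assume ne: "x \<noteq> a * b"
    then have "(0, a) \<noteq> (x, 0 :: real)" by auto
    with L have Leq: "L = line_through (0, a) (x, 0)" by (intro is_line_eq_line_through)
    define u where "u = b * (1 - a) / (x - a * b)"
    have "u * (x - a * b) = b * (1 - a)" using ne by (simp add: u_def)
    then have "u * x = b - (a - u * a) * b" by (simp add: algebra_simps)
    then have "(u * x, a - u * a) \<in> M" by (simp add: M)
    moreover have "(u * x, a - u * a) \<in> L"
      unfolding Leq line_through_iff by (intro exI[of _ u]) auto
    ultimately have "L = M" using L(3) by (auto simp: parallel_def)
    with L(2,4) have "0 = b - a * b" "x = b" by (simp_all add: M)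
    with ne show False by simp
  qed
qed

end

theory Submission
  imports Defs
begin

text \<open>
  The sign rules express symmetries of the figure that defines the geometric product.  Reflection in the \<open>y\<close>-axis keeps \<open>(0, a)\<close> and \<open>(0, 1)\<close>
  in place and negates both \<open>b\<close> and the \<open>x\<close>-intercept, which gives \<open>a \<odot> (- b) = - (a \<odot> b)\<close>.
  The half-turn about the origin carries the line through \<open>(0, a)\<close> to a line through \<open>(0, - a)\<close>
  with the opposite \<open>x\<close>-intercept; since a half-turn preserves the direction of every line, the
  new line is still parallel to the unchanged segment from \<open>(b, 0)\<close> to \<open>(0, 1)\<close>, which gives
  \<open>(- a) \<odot> b = - (a \<odot> b)\<close>.  The rule for two negative factors applies both symmetries.
\<close>

lemma geom_prod_line:
  obtains L where "is_line L" "(0, a) \<in> L" "parallel L (line_through (b, 0) (0, 1))"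
    "(a \<odot> b, 0) \<in> L"
  using theI'[OF geom_prod_well_defined[of a b]] unfolding geom_prod_def by blast

lemma geom_prod_eqI:
  assumes "is_line L" "(0, a) \<in> L" "parallel L (line_through (b, 0) (0, 1))" "(x, 0) \<in> L"
  shows "a \<odot> b = x"
  unfolding geom_prod_def by (rule the1_equality[OF geom_prod_well_defined]) (use assms in blast)

lemma linear_image_line_through:
  assumes "linear f"
  shows "f ` line_through p q = line_through (f p) (f q)"
  using affine_hull_linear_image[of f "{p, q}"] assms
  by (simp add: line_through_def linear_conv_bounded_linear)

lemma is_line_linear_image:
  assumes "linear f" "inj f" "is_line L"
  shows "is_line (f ` L)"
  using assms unfolding is_line_def by (metis injD linear_image_line_through)

lemma parallel_inj_image:
  assumes "inj f" "parallel L M"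
  shows "parallel (f ` L) (f ` M)"
  using assms by (auto simp: parallel_def image_Int[symmetric])

lemma is_line_line_through: "p \<noteq> q \<Longrightarrow> is_line (line_through p q)"
  unfolding is_line_def by blast

text \<open>
  Being equal or disjoint is not a transitive relation on sets, but for lines of the plane it
  amounts to being translates of one another, which is transitive.
\<close>

lemma parallel_trans:
  assumes "is_line L" "is_line M" "is_line N" "parallel L M" "parallel M N"
  shows "parallel L N"
  using assms by (metis parallel_iff_affine_parallel affine_parallel_assoc)

text \<open>
  For any two points \<open>p\<close> and \<open>q\<close> of the line, the half-turn about the origin is the half-turn
  about their midpoint, which maps the line onto itself, followed by the translation by
  \<open>- (p + q)\<close>; hence the image is a translate of the line.
\<close>

lemma parallel_half_turn:
  assumes "is_line L"
  shows "parallel (uminus ` L) L"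
proof -
  obtain p q where pq: "p \<noteq> q" "L = line_through p q"
    using assms by (auto simp: is_line_def)
  have "(\<lambda>x. - (p + q) + x) ` L = affine hull ((\<lambda>x. - (p + q) + x) ` {p, q})"
    unfolding pq line_through_def by (rule affine_hull_translation[symmetric])
  also have "\<dots> = line_through (- q) (- p)"
    by (simp add: line_through_def)
  also have "\<dots> = uminus ` L"
    unfolding pq linear_image_line_through[OF linear_uminus]
    by (simp add: line_through_def insert_commute)
  finally have "affine_parallel L (uminus ` L)"
    unfolding affine_parallel_def by metis
  moreover have "is_line (uminus ` L)"
    using assms by (intro is_line_linear_image linear_uminus) auto
  ultimately show ?thesis
    using assms by (simp add: parallel_iff_affine_parallel affine_parallel_commute)
qed

lemma geom_prod_minus_right: "a \<odot> (- b) = - (a \<odot> b)"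
proof -
  obtain L where L: "is_line L" "(0, a) \<in> L" "parallel L (line_through (b, 0) (0, 1))"
    "(a \<odot> b, 0) \<in> L" by (rule geom_prod_line)
  \<comment> \<open>the reflection in the \<open>y\<close>-axis\<close>
  define f :: "point \<Rightarrow> point" where "f = (\<lambda>z. (- fst z, snd z))"
  have lin: "linear f" and inj: "inj f"
    by (auto simp: f_def linear_iff inj_def prod_eq_iff)
  show ?thesis
  proof (rule geom_prod_eqI)
    show "is_line (f ` L)"
      using lin inj L(1) by (rule is_line_linear_image)
    show "(0, a) \<in> f ` L" "(- (a \<odot> b), 0) \<in> f ` L"
      using L(2,4) by (force simp: f_def)+
    have "f ` line_through (b, 0) (0, 1) = line_through (- b, 0) (0, 1)"
      unfolding linear_image_line_through[OF lin] by (simp add: f_def)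
    then show "parallel (f ` L) (line_through (- b, 0) (0, 1))"
      using parallel_inj_image[OF inj L(3)] by simp
  qed
qed

lemma geom_prod_minus_left: "(- a) \<odot> b = - (a \<odot> b)"
proof -
  obtain L where L: "is_line L" "(0, a) \<in> L" "parallel L (line_through (b, 0) (0, 1))"
    "(a \<odot> b, 0) \<in> L" by (rule geom_prod_line)
  show ?thesis
  proof (rule geom_prod_eqI)
    show line: "is_line (uminus ` L)"
      using L(1) by (intro is_line_linear_image linear_uminus) auto
    show "(0, - a) \<in> uminus ` L" "(- (a \<odot> b), 0) \<in> uminus ` L"
      using L(2,4) by force+
    show "parallel (uminus ` L) (line_through (b, 0) (0, 1))"
      using line L(1) is_line_line_through parallel_half_turn[OF L(1)] L(3)
      by (rule parallel_trans) simp
  qed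
qed

theorem theorem2:
  fixes a b :: real
  assumes "a > 0" and "b > 0"
  shows "(- a) \<odot> (- b) = a \<odot> b \<and>
    ((- a) \<odot> b = a \<odot> (- b) \<and> a \<odot> (- b) = - (a \<odot> b))"
  by (simp add: geom_prod_minus_left geom_prod_minus_right)

end
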